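(* Let $\mathcal{P}\subseteq\mathbb{R}^n$ be a polytope, $h:\mathcal{P}\to\mathbb{R}$ differentiable, and $x\in\mathcal{P}$. Let $g(\lambda)=\Pi_{\mathcal{P}}(x-\lambda\nabla h(x))$ for $\lambda\ge0$. Then the end point of this curve is $$\lim_{\lambda\to\infty}g(\lambda)=v^*=\arg\min_{v\in F}\|x-v\|^2,$$ where $F=\arg\min_{v\in\mathcal{P}}\langle\nabla h(x),v\rangle$ is the face of $\mathcal{P}$ minimizing the linear function given by the gradient $\nabla h(x)$. In particular, if $F$ is a vertex, then $\lim_{\lambda\to\infty}g(\lambda)=v^*$ is the Frank-Wolfe vertex.
   Context: $\Pi_{\mathcal{P}}$ is Euclidean projection onto $\mathcal{P}$ and $\|\cdot\|$ the Euclidean norm. A Frank-Wolfe vertex at $x$ is a vertex of $\mathcal{P}$ attaining $\min_{v\in\mathcal{P}}\langle\nabla h(x),v\rangle$. *)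

theory Defs
  imports "HOL-Analysis.Analysis"
begin

text \<open>The set of all minimizers, in contrast to \<^const>\<open>arg_min_on\<close>, which chooses one.\<close>

definition argmin_set :: "('a \<Rightarrow> real) \<Rightarrow> 'a set \<Rightarrow> 'a set" where
  "argmin_set f S = {v \<in> S. \<forall>w \<in> S. f v \<le> f w}"

text \<open>\<^term>\<open>d\<close> is the gradient of the objective at the current point.\<close>

definition frank_wolfe_vertex :: "'a::real_inner set \<Rightarrow> 'a \<Rightarrow> 'a \<Rightarrow> bool" where
  "frank_wolfe_vertex P d v \<longleftrightarrow> v extreme_point_of P \<and> v \<in> argmin_set (\<lambda>w. d \<bullet> w) P"

text \<open>
  The derivative is taken within \<^term>\<open>S\<close>, so the objective need only be given on \<^term>\<open>S\<close>.
  If a convex \<^term>\<open>S\<close> is not full-dimensional, the gradient is determined only up to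
  vectors orthogonal to the directions of the affine hull of \<^term>\<open>S\<close>; hence a relation, not a function.
\<close>

definition has_gradient_on ::
    "('a::real_inner \<Rightarrow> real) \<Rightarrow> ('a \<Rightarrow> 'a) \<Rightarrow> 'a set \<Rightarrow> bool" where
  "has_gradient_on h grad S \<longleftrightarrow>
     (\<forall>y \<in> S. (h has_derivative (\<lambda>u. grad y \<bullet> u)) (at y within S))"

end

theory Submission
  imports Defs
begin

text \<open>
  Write \<open>d\<close> for the gradient at \<open>x\<close>.  Expanding the square shows that the projection of
  \<open>x - l d\<close> onto \<open>P\<close> is the point of \<open>P\<close> minimizing the penalized objective
  \<open>\<parallel>x - v\<parallel>\<^sup>2 + 2 l (d \<bullet> v)\<close>.  As \<open>l\<close> grows the linear term dominates, and the
  squared distance only breaks ties among the minimizers of that linear term; this is why the curve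
  ends at the point of \<open>F\<close> closest to \<open>x\<close>.

  To make this precise, compare the value at \<open>g l\<close> with the value at
  the point \<open>p\<close> of \<open>F\<close> closest to \<open>x\<close> (lemma \<open>closest_point_shift_penalty\<close>).  Since
  \<open>d \<bullet> g l \<ge> d \<bullet> p\<close>, for \<open>l > 0\<close> this yields both that \<open>g l\<close> is no farther from \<open>x\<close> than \<open>p\<close>
  and that the linear excess \<open>d \<bullet> g l - d \<bullet> p\<close> is at most \<open>\<parallel>x - p\<parallel>\<^sup>2 / (2 l)\<close>,
  so it vanishes in the limit.  The only point of \<open>P\<close> with no linear excess and no
  excess distance is \<open>p\<close>, and in a compact set a curve along which a continuous function
  with a single zero, positive elsewhere, tends to \<open>0\<close> must converge to that zero (lemma \<open>tendsto_unique_zero_compact\<close>).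
\<close>

text \<open>
  Off a neighbourhood of the zero, the function attains a positive minimum by compactness,
  so its small values can occur only near the zero.
\<close>

lemma tendsto_unique_zero_compact:
  fixes \<phi> :: "'a::t2_space \<Rightarrow> real"
  assumes "compact K" and cont: "continuous_on K \<phi>"
    and pos: "\<And>v. v \<in> K \<Longrightarrow> v \<noteq> p \<Longrightarrow> \<phi> v > 0"
    and inK: "eventually (\<lambda>l. g l \<in> K) A"
    and lim: "((\<lambda>l. \<phi> (g l)) \<longlongrightarrow> 0) A"
  shows "(g \<longlongrightarrow> p) A"
proof (rule topological_tendstoI)
  fix U assume "open U" "p \<in> U"
  have comp: "compact (K - U)"
    using \<open>compact K\<close> \<open>open U\<close> by (rule compact_diff)
  show "eventually (\<lambda>l. g l \<in> U) A"
  proof (cases "K - U = {}")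
    case True
    then show ?thesis
      using inK by (auto elim: eventually_mono)
  next
    case False
    obtain q where q: "q \<in> K - U" "\<And>v. v \<in> K - U \<Longrightarrow> \<phi> q \<le> \<phi> v"
      using continuous_attains_inf[OF comp False] continuous_on_subset[OF cont] by blast
    have "\<phi> q > 0"
      using q(1) \<open>p \<in> U\<close> by (intro pos) auto
    then have "eventually (\<lambda>l. \<phi> (g l) < \<phi> q) A"
      using lim by (rule order_tendstoD(2)[rotated])
    with inK show ?thesis
      by eventually_elim (use q(2) in force)
  qed
qed

lemma argmin_set_linear_face_of:
  assumes "convex P"
  shows "argmin_set (\<lambda>v. d \<bullet> v) P face_of P"
proof (cases "argmin_set (\<lambda>v. d \<bullet> v) P = {}")
  case False
  then obtain p where p: "p \<in> argmin_set (\<lambda>v. d \<bullet> v) P"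
    by blast
  then have "argmin_set (\<lambda>v. d \<bullet> v) P = P \<inter> {v. d \<bullet> v = d \<bullet> p}"
    by (force simp: argmin_set_def)
  moreover have "(P \<inter> {v. d \<bullet> v = d \<bullet> p}) face_of P"
    using p by (intro face_of_Int_supporting_hyperplane_ge[OF assms]) (auto simp: argmin_set_def)
  ultimately show ?thesis
    by simp
qed simp

lemma argmin_set_nonempty:
  assumes "compact S" "S \<noteq> {}" "continuous_on S f"
  shows "argmin_set f S \<noteq> {}"
  using continuous_attains_inf[OF assms] by (auto simp: argmin_set_def)

lemma argmin_set_dist_eq_closest_point:
  fixes S :: "'a::euclidean_space set"
  assumes "closed S" "convex S" "S \<noteq> {}"
  shows "argmin_set (\<lambda>v. (norm (x - v))\<^sup>2) S = {closest_point S x}"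
proof -
  have "v = closest_point S x" if "v \<in> argmin_set (\<lambda>v. (norm (x - v))\<^sup>2) S" for v
    using that by (intro closest_point_unique[OF assms(2,1)])
      (auto simp: argmin_set_def dist_norm)
  moreover have "closest_point S x \<in> argmin_set (\<lambda>v. (norm (x - v))\<^sup>2) S"
    using closest_point_in_set[OF assms(1,3)] closest_point_le[OF assms(1)]
    by (auto simp: argmin_set_def dist_norm)
  ultimately show ?thesis
    by blast
qed

text \<open>
  Expanding \<open>\<parallel>(x - l d) - v\<parallel>\<^sup>2\<close> gives the penalized objective plus terms
  independent of \<open>v\<close>.
\<close>

lemma closest_point_shift_penalty:
  fixes P :: "'a::euclidean_space set" and x d :: 'a and l :: real
  assumes "closed P" "p \<in> P"
  defines "q \<equiv> closest_point P (x - l *\<^sub>R d)"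
  shows "(norm (x - q))\<^sup>2 + 2 * l * (d \<bullet> q) \<le> (norm (x - p))\<^sup>2 + 2 * l * (d \<bullet> p)"
proof -
  have expand: "(norm ((x - l *\<^sub>R d) - v))\<^sup>2
      = (norm (x - v))\<^sup>2 + 2 * l * (d \<bullet> v) + ((norm (l *\<^sub>R d))\<^sup>2 - 2 * l * (d \<bullet> x))" for v
    unfolding power2_norm_eq_inner by (simp add: inner_diff inner_commute algebra_simps)
  have "norm ((x - l *\<^sub>R d) - q) \<le> norm ((x - l *\<^sub>R d) - p)"
    using closest_point_le[OF assms(1,2), of "x - l *\<^sub>R d"] by (simp add: q_def dist_norm)
  then have "(norm ((x - l *\<^sub>R d) - q))\<^sup>2 \<le> (norm ((x - l *\<^sub>R d) - p))\<^sup>2"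
    by (rule power_mono) simp
  then show ?thesis
    unfolding expand by simp
qed

text \<open>
  The closest point of \<open>F\<close> competes in the projection for every \<open>l\<close>; no point of \<open>P\<close> has a
  smaller linear value, so the projection beats it only by being nearer to \<open>x\<close>, and
  that bounded gain pays for a linear excess of order \<open>1 / l\<close> at most.
\<close>

lemma closest_point_ray_tendsto:
  fixes P :: "'a::euclidean_space set" and x d :: 'a
  assumes "compact P" "convex P" "P \<noteq> {}"
  defines "F \<equiv> argmin_set (\<lambda>v. d \<bullet> v) P"
  shows "((\<lambda>l. closest_point P (x - l *\<^sub>R d)) \<longlongrightarrow> closest_point F x) at_top"
proof -
  define p where "p = closest_point F x"
  define g where "g l = closest_point P (x - l *\<^sub>R d)" for l
  (* Linear excess plus the positive part of the excess squared distance: p is its only zero on P. *)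
  define \<phi> where "\<phi> v = (d \<bullet> v - d \<bullet> p) + max 0 ((norm (x - v))\<^sup>2 - (norm (x - p))\<^sup>2)" for v
  have "closed P"
    using \<open>compact P\<close> by (rule compact_imp_closed)
  have face: "F face_of P"
    unfolding F_def by (rule argmin_set_linear_face_of[OF \<open>convex P\<close>])
  have "closed F" "convex F"
    using face_of_imp_compact[OF \<open>convex P\<close> \<open>compact P\<close> face] face_of_imp_convex[OF face]
    by (auto intro: compact_imp_closed)
  have "F \<noteq> {}"
    unfolding F_def by (intro argmin_set_nonempty assms continuous_intros)
  have p_min: "argmin_set (\<lambda>v. (norm (x - v))\<^sup>2) F = {p}"
    unfolding p_def
    by (rule argmin_set_dist_eq_closest_point[OF \<open>closed F\<close> \<open>convex F\<close> \<open>F \<noteq> {}\<close>])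
  then have "p \<in> F"
    by (auto simp: argmin_set_def)
  then have "p \<in> P" and lin: "\<And>v. v \<in> P \<Longrightarrow> d \<bullet> p \<le> d \<bullet> v"
    by (auto simp: F_def argmin_set_def)
  have inP: "g l \<in> P" for l
    unfolding g_def by (rule closest_point_in_set[OF \<open>closed P\<close> \<open>P \<noteq> {}\<close>])

  have pos: "\<phi> v > 0" if "v \<in> P" "v \<noteq> p" for v
  proof (rule ccontr)
    assume "\<not> \<phi> v > 0"
    with lin[OF \<open>v \<in> P\<close>] have "d \<bullet> v = d \<bullet> p" and near: "(norm (x - v))\<^sup>2 \<le> (norm (x - p))\<^sup>2"
      unfolding \<phi>_def by linarith+
    then have "v \<in> F"
      using \<open>v \<in> P\<close> lin by (auto simp: F_def argmin_set_def)
    moreover have "(norm (x - p))\<^sup>2 \<le> (norm (x - w))\<^sup>2" if "w \<in> F" for w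
      using p_min that by (auto simp: argmin_set_def)
    ultimately have "v \<in> argmin_set (\<lambda>v. (norm (x - v))\<^sup>2) F"
      using near by (force simp: argmin_set_def)
    with p_min \<open>v \<noteq> p\<close> show False
      by simp
  qed

  have bounds: "0 \<le> \<phi> (g l) \<and> \<phi> (g l) \<le> (norm (x - p))\<^sup>2 / 2 / l" if "l > 0" for l
  proof -
    have le: "(norm (x - g l))\<^sup>2 + 2 * l * (d \<bullet> g l - d \<bullet> p) \<le> (norm (x - p))\<^sup>2"
      using closest_point_shift_penalty[OF \<open>closed P\<close> \<open>p \<in> P\<close>, of x l d]
      by (simp add: g_def algebra_simps)
    have excess: "0 \<le> d \<bullet> g l - d \<bullet> p"
      using lin[OF inP] by simp
    then have "0 \<le> 2 * l * (d \<bullet> g l - d \<bullet> p)"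
      using that by simp
    then have eq: "\<phi> (g l) = d \<bullet> g l - d \<bullet> p"
      using le by (simp add: \<phi>_def)
    have "2 * l * (d \<bullet> g l - d \<bullet> p) \<le> (norm (x - p))\<^sup>2"
      using le zero_le_power2[of "norm (x - g l)"] by linarith
    then have "\<phi> (g l) \<le> (norm (x - p))\<^sup>2 / 2 / l"
      unfolding eq using that by (simp add: field_simps)
    then show ?thesis
      using excess eq by simp
  qed

  have nonneg: "eventually (\<lambda>l. 0 \<le> \<phi> (g l)) at_top"
    using eventually_gt_at_top[of 0] by eventually_elim (simp add: bounds)
  have upper: "eventually (\<lambda>l. \<phi> (g l) \<le> (norm (x - p))\<^sup>2 / 2 / l) at_top"
    using eventually_gt_at_top[of 0] by eventually_elim (rule conjunct2[OF bounds])
  have "((\<lambda>l. (norm (x - p))\<^sup>2 / 2 / l) \<longlongrightarrow> 0) at_top"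
    by (rule tendsto_divide_0[OF tendsto_const filterlim_at_top_imp_at_infinity[OF filterlim_ident]])
  then have "((\<lambda>l. \<phi> (g l)) \<longlongrightarrow> 0) at_top"
    by (rule tendsto_sandwich[OF nonneg upper tendsto_const])
  moreover have "continuous_on P \<phi>"
    unfolding \<phi>_def by (intro continuous_intros)
  ultimately have "(g \<longlongrightarrow> p) at_top"
    using \<open>compact P\<close> pos inP
    by (intro tendsto_unique_zero_compact[where K = P and \<phi> = \<phi>]) simp_all
  then show ?thesis
    by (simp add: g_def[abs_def] p_def)
qed

theorem theorem7:
  fixes P F :: "(real ^ 'n) set"
    and h :: "real ^ 'n \<Rightarrow> real"
    and grad :: "real ^ 'n \<Rightarrow> real ^ 'n"
    and x :: "real ^ 'n"
    and g :: "real \<Rightarrow> real ^ 'n"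
  assumes "polytope P"
    and "has_gradient_on h grad P"
    and "x \<in> P"
    and "\<And>l. l \<ge> 0 \<Longrightarrow> g l = closest_point P (x - l *\<^sub>R grad x)"
    and "F = argmin_set (\<lambda>v. grad x \<bullet> v) P"
  shows "F face_of P \<and>
    (\<exists>vstar. argmin_set (\<lambda>v. (norm (x - v))\<^sup>2) F = {vstar} \<and>
       (g \<longlongrightarrow> vstar) at_top \<and>
       ((\<exists>w. w extreme_point_of P \<and> F = {w}) \<longrightarrow>
          {v. frank_wolfe_vertex P (grad x) v} = {vstar}))"
proof -
  have P: "compact P" "convex P" "P \<noteq> {}"
    using assms(1,3) by (auto intro: polytope_imp_compact polytope_imp_convex)
  have face: "F face_of P"
    unfolding assms(5) by (rule argmin_set_linear_face_of[OF P(2)])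
  have "closed F" "convex F"
    using face_of_imp_compact[OF P(2,1) face] face_of_imp_convex[OF face]
    by (auto intro: compact_imp_closed)
  have "F \<noteq> {}"
    unfolding assms(5) by (intro argmin_set_nonempty P continuous_intros)
  have argmin: "argmin_set (\<lambda>v. (norm (x - v))\<^sup>2) F = {closest_point F x}"
    by (rule argmin_set_dist_eq_closest_point[OF \<open>closed F\<close> \<open>convex F\<close> \<open>F \<noteq> {}\<close>])
  have "eventually (\<lambda>l. closest_point P (x - l *\<^sub>R grad x) = g l) at_top"
    using eventually_ge_at_top[of 0] by eventually_elim (simp add: assms(4))
  then have lim: "(g \<longlongrightarrow> closest_point F x) at_top"
    using closest_point_ray_tendsto[OF P, of x "grad x"] unfolding assms(5)
    by (rule Lim_transform_eventually[rotated])
  have "{v. frank_wolfe_vertex P (grad x) v} = {closest_point F x}"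
    if "w extreme_point_of P" "F = {w}" for w
  proof -
    have "{v. frank_wolfe_vertex P (grad x) v} = {w}"
      using that assms(5) by (auto simp: frank_wolfe_vertex_def)
    moreover have "closest_point F x = w"
      using closest_point_in_set[OF \<open>closed F\<close> \<open>F \<noteq> {}\<close>, of x] that(2) by simp
    ultimately show ?thesis
      by simp
  qed
  with face argmin lim show ?thesis
    by blast
qed

end
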